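(* Let $y=(y_1,y_2,y_3)\in\mathbb{C}^3$ be such that $\max\{|y_1|,|y_2|\}+|y_3|\leq 1$. Let $\varphi:\mathbb{D}\to\mathbb{C}^3$ be given by $$\varphi(\lambda)=\frac{\lambda}{1+\lambda\,\overline{y_3}\,C(y)}\,\bigl(y_1,\;y_2,\;C(y)\lambda+y_3\bigr),$$ where $$C(y)=\begin{cases}0 & \text{if } y_1=y_2=0,\\[4pt] \dfrac{y_1y_2(1-|y_1|)}{|y_1|\,(1-|y_1|-|y_3|^2)} & \text{if } |y_2|\leq|y_1|\neq 0,\\[10pt] \dfrac{y_1y_2(1-|y_2|)}{|y_2|\,(1-|y_2|-|y_3|^2)} & \text{if } |y_1|\leq|y_2|\neq 0.\end{cases}$$ Then $\varphi$ is an analytic map from $\mathbb{D}$ to $\mathbb{E}$, $\varphi(0)=(0,0,0)$ and $\varphi'(0)=y$.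
   Context: $\mathbb{D}=\{z\in\mathbb{C}:|z|<1\}$ is the open unit disc. The tetrablock is the domain $$\mathbb{E}=\{(x_1,x_2,x_3)\in\mathbb{C}^3: 1-x_1z-x_2w+x_3zw\neq 0 \text{ for all } z,w\in\mathbb{C} \text{ with } |z|\leq 1,\ |w|\leq 1\}.$$ "Analytic" means holomorphic.
   Formalization: When max{|y1|,|y2|} = 1 (so y3 = 0) the formula for C(y) reads 0/0 and is undefined; there C(y) is taken to be its limiting value y1·y2, and everywhere else the formula is used as stated. *)

theory Defs
  imports "HOL-Complex_Analysis.Complex_Analysis"
begin

(* Otherwise the symbol for vector components is ambiguous. *)
no_notation fps_nth (infixl "$" 75)

definition tetrablock :: "(complex ^ 3) set" where
  "tetrablock = {x. \<forall>z w. cmod z \<le> 1 \<longrightarrow> cmod w \<le> 1 \<longrightarrow>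
      1 - x $ 1 * z - x $ 2 * w + x $ 3 * z * w \<noteq> 0}"

(* For max |y1| |y2| + |y3| <= 1, the quotient defining C(y) degenerates, to 0/0, exactly when
   max |y1| |y2| = 1 and y3 = 0.  The second branch gives C(y) its limiting value there:
   with r = max |y1| |y2| in {0<..<1} and s = |y3| <= 1 - r, the factor (1 - r) / (1 - r - s^2)
   lies between 1 and 1 / r, so it tends to 1 as r tends to 1.  (For s = 0 and r < 1 it equals 1.)
   The convention x / 0 = 0 would instead give C(y) = 0, and then l * (1, 1, 0) leaves the
   tetrablock for 1/2 <= |l| < 1.
   When |y1| = |y2|, the last two branches give the same value. *)
definition schwarz_coeff :: "complex \<Rightarrow> complex \<Rightarrow> complex \<Rightarrow> complex" where
  "schwarz_coeff y1 y2 y3 =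
    (if y1 = 0 \<and> y2 = 0 then 0
     else if max (cmod y1) (cmod y2) = 1 \<and> y3 = 0 then y1 * y2
     else if cmod y2 \<le> cmod y1 then
       y1 * y2 * of_real (1 - cmod y1) / of_real (cmod y1 * (1 - cmod y1 - (cmod y3)\<^sup>2))
     else
       y1 * y2 * of_real (1 - cmod y2) / of_real (cmod y2 * (1 - cmod y2 - (cmod y3)\<^sup>2)))"

definition schwarz_map :: "complex \<Rightarrow> complex \<Rightarrow> complex \<Rightarrow> complex \<Rightarrow> complex ^ 3" where
  "schwarz_map y1 y2 y3 l =
    (l / (1 + l * cnj y3 * schwarz_coeff y1 y2 y3)) *s
      vector [y1, y2, schwarz_coeff y1 y2 y3 * l + y3]"

end

theory Submission
  imports Defs
begin

text \<open>
  Clearing the denominator \<open>1 + \<lambda> \<cdot> cnj y3 \<cdot> C\<close>, membership of \<open>\<phi>(\<lambda>)\<close> in the tetrablock says that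
  \<open>F(\<lambda>, z, w) = 1 + \<lambda> (C \<cdot> cnj y3 - y1 z - y2 w + y3 z w) + \<lambda>\<^sup>2 C z w\<close>
  does not vanish for \<open>|\<lambda>| < 1\<close> and \<open>|z|, |w| \<le> 1\<close>. At \<open>z = w = 0\<close> this is the denominator
  itself, so the same fact makes \<open>\<phi>\<close> holomorphic, and its derivative at \<open>0\<close> is then immediate.

  On the torus \<open>|z| = |w| = 1\<close> the idea is to write the quadratic in \<open>\<lambda>\<close> as
  \<open>1 + (b + c \<cdot> cnj b) \<lambda> + c \<lambda>\<^sup>2\<close> with \<open>|b| \<le> 1\<close> and \<open>|c| \<le> 1\<close>, where \<open>c = C z w\<close>. It then equals
  \<open>(1 + b \<lambda>) + c \<lambda> (\<lambda> + cnj b)\<close>, whose first summand dominates because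
  the Blaschke factor \<open>(\<lambda> + cnj b) / (1 + b \<lambda>)\<close> has modulus at most \<open>1\<close> on the disc: see \<open>schur_quadratic_nonzero\<close>.
  Comparison of coefficients suggests \<open>b = y3 z w - p y1 z - q y2 w\<close> with real \<open>p, q \<ge> 0\<close>, for which
  \<open>|b| \<le> |y3| + p |y1| + q |y2|\<close>. Finding such weights \<open>p\<close> and \<open>q\<close> with this sum at most \<open>1\<close> is where
  the particular value of \<open>C\<close> enters: see \<open>schwarz_coeff_factor\<close> and \<open>schwarz_coeff_weights\<close>.

  The passage from the torus to the closed bidisc is a connectedness argument in \<open>\<lambda>\<close>, applied to one
  variable at a time: see \<open>affine_nonzero_on_closed_disc\<close>.
\<close>

section \<open>Zeros of quadratic and affine functions\<close>

text \<open>
  This is the sufficiency half of the Schur--Cohn criterion for a quadratic, with the Schur parameter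
  \<open>b\<close> given explicitly. Unlike the bound \<open>|a - c \<cdot> cnj a| \<le> 1 - |c|\<^sup>2\<close> on the middle coefficient
  \<open>a = b + c \<cdot> cnj b\<close>, this form remains sufficient when \<open>|c| = 1\<close>.
\<close>

lemma schur_quadratic_nonzero:
  fixes b c l :: complex
  assumes "cmod b \<le> 1" "cmod c \<le> 1" "cmod l < 1"
  shows "1 + (b + c * cnj b) * l + c * l\<^sup>2 \<noteq> 0"
proof
  assume zero: "1 + (b + c * cnj b) * l + c * l\<^sup>2 = 0"
  have "cmod (b * l) \<le> cmod l"
    using assms(1) by (simp add: norm_mult mult_left_le_one_le)
  then have nz: "1 + b * l \<noteq> 0"
    using assms(3) by (metis add.commute add_eq_0_iff2 norm_minus_cancel norm_one not_less)
  have "(cmod (1 + b * l))\<^sup>2 - (cmod (l + cnj b))\<^sup>2 = (1 - (cmod l)\<^sup>2) * (1 - (cmod b)\<^sup>2)"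
    unfolding cmod_power2 by (simp add: power2_eq_square algebra_simps)
  moreover have "\<dots> \<ge> 0"
    using assms by (intro mult_nonneg_nonneg) (simp_all add: power_le_one)
  ultimately have "(cmod (l + cnj b))\<^sup>2 \<le> (cmod (1 + b * l))\<^sup>2"
    by linarith
  then have le: "cmod (l + cnj b) \<le> cmod (1 + b * l)"
    by (rule power2_le_imp_le) simp
  have "(1 + b * l) + c * l * (l + cnj b) = 0"
    using zero by (simp add: power2_eq_square algebra_simps)
  then have "1 + b * l = - (c * l * (l + cnj b))"
    by (simp only: add_eq_0_iff2)
  then have "cmod (1 + b * l) = cmod c * cmod l * cmod (l + cnj b)"
    by (simp only: norm_minus_cancel norm_mult)
  also have "\<dots> \<le> 1 * cmod l * cmod (1 + b * l)"
    using assms le by (intro mult_mono) simp_all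
  also have "\<dots> < 1 * cmod (1 + b * l)"
    using assms nz by simp
  finally show False by simp
qed

text \<open>
  An affine function \<open>P + Q z\<close> has a zero on the unit circle if and only if \<open>|P| = |Q|\<close>, and a zero in
  the closed disc that avoids the circle means \<open>|P| < |Q|\<close>. As the parameter moves from \<open>0\<close>, where
  \<open>|P| \<ge> |Q|\<close>, that inequality cannot arise without the equality occurring on the way.
\<close>

lemma affine_nonzero_on_closed_disc:
  fixes P Q :: "'a :: topological_space \<Rightarrow> complex"
  assumes S: "connected S" "a \<in> S" "Q a = 0"
    and cont: "continuous_on S P" "continuous_on S Q"
    and circle: "\<And>l z. l \<in> S \<Longrightarrow> cmod z = 1 \<Longrightarrow> P l + Q l * z \<noteq> 0"
    and l: "l \<in> S" and z: "cmod z \<le> 1"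
  shows "P l + Q l * z \<noteq> 0"
proof
  assume "P l + Q l * z = 0"
  then have "cmod (P l) = cmod (Q l) * cmod z"
    by (metis add_eq_0_iff2 norm_minus_cancel norm_mult)
  then have le: "cmod (P l) - cmod (Q l) \<le> 0"
    using z by (simp add: mult_left_le)
  have "connected ((\<lambda>m. cmod (P m) - cmod (Q m)) ` S)"
    by (intro connected_continuous_image continuous_intros S cont)
  moreover have "cmod (P a) - cmod (Q a) \<ge> 0"
    using S by simp
  ultimately have "0 \<in> (\<lambda>m. cmod (P m) - cmod (Q m)) ` S"
    using le l S(2) by (meson connectedD_interval image_eqI)
  then obtain m where m: "m \<in> S" "cmod (P m) = cmod (Q m)"
    by auto
  show False
  proof (cases "Q m = 0")
    case True
    then show False using circle[OF m(1), of 1] m(2) by simp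
  next
    case False
    then show False
      using circle[OF m(1), of "- P m / Q m"] m(2) by (simp add: norm_divide)
  qed
qed

section \<open>The defining polynomial along the map\<close>

text \<open>
  The hypotheses on the weights \<open>p\<close> and \<open>q\<close> say that \<open>b = y3 z w - p y1 z - q y2 w\<close> satisfies
  \<open>b + C z w \<cdot> cnj b = C \<cdot> cnj y3 - y1 z - y2 w + y3 z w\<close> whenever \<open>|z| = |w| = 1\<close>, and that \<open>|b| \<le> 1\<close>.
\<close>

lemma nonzero_on_torus:
  fixes C y1 y2 y3 l z w :: complex and p q :: real
  assumes pq: "p \<ge> 0" "q \<ge> 0"
    and eq1: "p * y1 + q * C * cnj y2 = y1"
    and eq2: "q * y2 + p * C * cnj y1 = y2"
    and C: "cmod C \<le> 1"
    and bound: "cmod y3 + p * cmod y1 + q * cmod y2 \<le> 1"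
    and l: "cmod l < 1" and z: "cmod z = 1" and w: "cmod w = 1"
  shows "1 + l * (C * cnj y3 - y1 * z - y2 * w + y3 * z * w) + l\<^sup>2 * C * z * w \<noteq> 0"
proof -
  define b where "b = y3 * z * w - p * y1 * z - q * y2 * w"
  have zz: "z * cnj z = 1" and ww: "w * cnj w = 1"
    using z w by (simp_all flip: complex_norm_square)
  have "C * z * w * cnj b = C * cnj y3 * (z * cnj z) * (w * cnj w)
      - (p * C * cnj y1) * w * (z * cnj z) - (q * C * cnj y2) * z * (w * cnj w)"
    by (simp add: b_def algebra_simps)
  also have "\<dots> = C * cnj y3 - (p * C * cnj y1) * w - (q * C * cnj y2) * z"
    by (simp add: zz ww)
  finally have "b + C * z * w * cnj b = C * cnj y3 + y3 * z * w
      - (p * y1 + q * C * cnj y2) * z - (q * y2 + p * C * cnj y1) * w"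
    by (simp add: b_def algebra_simps)
  then have b: "b + C * z * w * cnj b = C * cnj y3 - y1 * z - y2 * w + y3 * z * w"
    by (simp add: eq1 eq2)
  have "cmod b \<le> cmod (y3 * z * w) + cmod (p * y1 * z) + cmod (q * y2 * w)"
    unfolding b_def by (meson add_right_mono norm_triangle_ineq4 order_trans)
  also have "\<dots> \<le> 1"
    using bound pq z w by (simp add: norm_mult)
  finally have "1 + (b + C * z * w * cnj b) * l + C * z * w * l\<^sup>2 \<noteq> 0"
    using C l z w by (intro schur_quadratic_nonzero) (simp_all add: norm_mult)
  then show ?thesis
    unfolding b by (simp add: mult_ac)
qed

lemma nonzero_on_closed_bidisc:
  fixes C y1 y2 y3 l z w :: complex
  assumes torus: "\<And>l z w. cmod l < 1 \<Longrightarrow> cmod z = 1 \<Longrightarrow> cmod w = 1 \<Longrightarrow>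
      1 + l * (C * cnj y3 - y1 * z - y2 * w + y3 * z * w) + l\<^sup>2 * C * z * w \<noteq> 0"
    and l: "cmod l < 1" and z: "cmod z \<le> 1" and w: "cmod w \<le> 1"
  shows "1 + l * (C * cnj y3 - y1 * z - y2 * w + y3 * z * w) + l\<^sup>2 * C * z * w \<noteq> 0"
proof -
  define F where
    "F l z w = 1 + l * (C * cnj y3 - y1 * z - y2 * w + y3 * z * w) + l\<^sup>2 * C * z * w" for l z w
  have affine_z: "F l z w = (1 + l * (C * cnj y3 - y2 * w)) + l * (y3 * w - y1 + l * C * w) * z"
    and affine_w: "F l z w = (1 + l * (C * cnj y3 - y1 * z)) + l * (y3 * z - y2 + l * C * z) * w"
    for l z w by (simp_all add: F_def algebra_simps power2_eq_square)
  have circle: "F m z v \<noteq> 0" if m: "m \<in> ball 0 1" and v: "cmod v = 1" for m v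
    unfolding affine_z
  proof (rule affine_nonzero_on_closed_disc[where S = "ball 0 1" and a = 0
        and P = "\<lambda>m. 1 + m * (C * cnj y3 - y2 * v)" and Q = "\<lambda>m. m * (y3 * v - y1 + m * C * v)"])
    fix l u :: complex
    assume "l \<in> ball 0 1" "cmod u = 1"
    then show "(1 + l * (C * cnj y3 - y2 * v)) + l * (y3 * v - y1 + l * C * v) * u \<noteq> 0"
      using torus v unfolding affine_z[symmetric] F_def by simp
  qed (use m z in \<open>auto intro!: continuous_intros\<close>)
  have "F l z w \<noteq> 0"
    unfolding affine_w
  proof (rule affine_nonzero_on_closed_disc[where S = "ball 0 1" and a = 0
        and P = "\<lambda>l. 1 + l * (C * cnj y3 - y1 * z)" and Q = "\<lambda>l. l * (y3 * z - y2 + l * C * z)"])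
    fix l u :: complex
    assume "l \<in> ball 0 1" "cmod u = 1"
    then show "(1 + l * (C * cnj y3 - y1 * z)) + l * (y3 * z - y2 + l * C * z) * u \<noteq> 0"
      using circle unfolding affine_w[symmetric] by simp
  qed (use l w in \<open>auto intro!: continuous_intros\<close>)
  then show ?thesis
    by (simp add: F_def)
qed

section \<open>The coefficient\<close>

lemma schwarz_coeff_commute: "schwarz_coeff y1 y2 y3 = schwarz_coeff y2 y1 y3"
  by (auto simp: schwarz_coeff_def max.commute mult_ac)

text \<open>
  With \<open>r = |y1|\<close>, \<open>t = |y2|\<close> and \<open>s = |y3|\<close>, the factor is \<open>k = (1 - r) / (1 - r - s\<^sup>2)\<close>, or \<open>1\<close> in
  the degenerate case. Since \<open>s \<le> 1 - r\<close>, it is at most \<open>1 / r\<close>. The last inequality is affine in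
  \<open>t\<close>, so it is enough to have it at \<open>t = 0\<close>, where it is \<open>r + s \<le> 1\<close>, and at \<open>t = r\<close>, where after
  clearing the denominator it reads \<open>(1 - r - s) (1 - r - s\<^sup>2 - r s) \<ge> 0\<close>.
\<close>

lemma schwarz_coeff_factor:
  fixes y1 y2 y3 :: complex
  assumes t: "cmod y2 \<le> cmod y1" and y1: "y1 \<noteq> 0" and s: "cmod y1 + cmod y3 \<le> 1"
  obtains k :: real where "schwarz_coeff y1 y2 y3 = y1 * y2 * k / cmod y1"
    "0 \<le> k" "k * cmod y1 \<le> 1"
    "cmod y1 + cmod y2 \<le> (1 - cmod y3) * (1 + cmod y2 * k)"
proof (cases "cmod y1 = 1")
  case True
  then have "y3 = 0"
    using s by simp
  then show ?thesis
    using True t y1 by (intro that[of 1]) (simp_all add: schwarz_coeff_def max_absorb1)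
next
  case False
  define r s t where rst: "r = cmod y1" "s = cmod y3" "t = cmod y2"
  have r: "0 < r" "r < 1" and s': "0 \<le> s" "s \<le> 1 - r" and t': "0 \<le> t" "t \<le> r"
    using False y1 s t norm_ge_zero[of y3] unfolding rst by (simp_all del: norm_ge_zero, simp_all)
  define d where "d = 1 - r - s\<^sup>2"
  have "s\<^sup>2 \<le> (1 - r)\<^sup>2"
    using s' by (intro power_mono)
  then have d: "r * (1 - r) \<le> d"
    by (simp add: d_def power2_eq_square algebra_simps)
  moreover have "0 < r * (1 - r)"
    using r by simp
  ultimately have d0: "0 < d"
    by linarith
  define k where "k = (1 - r) / d"
  have k: "0 \<le> k" "k * r \<le> 1"
    using d d0 r by (simp_all add: k_def field_simps)
  have "s * (s + r) \<le> s * 1"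
    using s' by (intro mult_left_mono) simp_all
  then have "0 \<le> (1 - r - s) * (1 - r - s\<^sup>2 - r * s)"
    using s' by (intro mult_nonneg_nonneg) (simp_all add: power2_eq_square algebra_simps)
  also have "\<dots> = (1 - s - 2 * r) * d + (1 - s) * r * (1 - r)"
    by (simp add: d_def power2_eq_square algebra_simps)
  also have "\<dots> = d * ((1 - s) * (1 + r * k) - 2 * r)"
    using d0 by (simp add: k_def field_simps)
  finally have at_r: "2 * r \<le> (1 - s) * (1 + r * k)"
    using d0 by (simp add: zero_le_mult_iff)
  \<comment> \<open>Convex combination, with weights \<open>(r - t) / r\<close> and \<open>t / r\<close>, of the inequalities at \<open>0\<close> and at \<open>r\<close>.\<close>
  have "(r - t) * r + t * (2 * r) \<le> (r - t) * (1 - s) + t * ((1 - s) * (1 + r * k))"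
    using s' t' at_r by (intro add_mono mult_left_mono) simp_all
  then have "r * (r + t) \<le> r * ((1 - s) * (1 + t * k))"
    by (simp add: algebra_simps)
  then have "r + t \<le> (1 - s) * (1 + t * k)"
    using r by simp
  moreover have "schwarz_coeff y1 y2 y3 = y1 * y2 * k / r"
    using False y1 t by (simp add: schwarz_coeff_def k_def d_def rst max_absorb1 mult_ac)
  ultimately show ?thesis
    using k by (intro that[of k]) (simp_all add: rst)
qed

text \<open>
  Since \<open>C \<cdot> cnj y1\<close> is a real multiple of \<open>y2\<close>, and \<open>C \<cdot> cnj y2\<close> one of \<open>y1\<close>, the two equations are a
  real linear system for \<open>p\<close> and \<open>q\<close> with determinant \<open>1 - |C|\<^sup>2\<close>. With \<open>r = |y1|\<close> and \<open>t = |y2|\<close>,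
  it has a solution for which \<open>p r + q t = (r + t) / (1 + |C|)\<close>, and since \<open>|C| = t k\<close>, the last bound
  of \<open>schwarz_coeff_factor\<close> says exactly that this is at most \<open>1 - |y3|\<close>.
\<close>

lemma schwarz_coeff_weights_ordered:
  fixes y1 y2 y3 C :: complex
  assumes t: "cmod y2 \<le> cmod y1" and s: "cmod y1 + cmod y3 \<le> 1"
  defines "C \<equiv> schwarz_coeff y1 y2 y3"
  shows "cmod C \<le> 1 \<and> (\<exists>p q :: real. p \<ge> 0 \<and> q \<ge> 0 \<and>
    p * y1 + q * C * cnj y2 = y1 \<and> q * y2 + p * C * cnj y1 = y2 \<and>
    cmod y3 + p * cmod y1 + q * cmod y2 \<le> 1)"
proof (cases "y1 = 0")
  case True
  then show ?thesis
    using s t by (auto simp: C_def schwarz_coeff_def intro!: exI[of _ 0])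
next
  case False
  obtain k :: real where k: "C = y1 * y2 * k / cmod y1" "0 \<le> k" "k * cmod y1 \<le> 1"
    "cmod y1 + cmod y2 \<le> (1 - cmod y3) * (1 + cmod y2 * k)"
    using schwarz_coeff_factor[OF t False s] unfolding C_def by metis
  define r t c where rt: "r = cmod y1" "t = cmod y2" and c: "c = t * k"
  have r: "0 < r" and t': "0 \<le> t" "t \<le> r"
    using False t by (simp_all add: rt)
  have kr: "k * r \<le> 1"
    using k by (simp add: rt)
  have "t * k \<le> r * k"
    using t' k(2) by (intro mult_right_mono)
  then have c': "0 \<le> c" "c \<le> 1" "c * t \<le> r"
    using kr k(2) t' mult_mono[of c 1 t r] by (simp_all add: c mult.commute)
  have "y1 * cnj y1 = of_real (r * r)" "y2 * cnj y2 = of_real (t * t)"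
    by (simp_all only: rt complex_norm_square flip: power2_eq_square)
  then have C1: "C * cnj y1 = of_real (k * r) * y2" and C2: "C * cnj y2 = of_real (c * t / r) * y1"
    using r by (simp_all add: k(1) c rt field_simps)
  have C: "cmod C = c"
    using r k(2) by (simp add: k(1) c norm_mult norm_divide rt)
  obtain p q where pq: "0 \<le> p" "0 \<le> q" "p + q * (c * t / r) = 1" "q + p * (k * r) = 1"
    "(p * r + q * t) * (1 + c) = r + t"
  proof (cases "c = 1")
    case True
    \<comment> \<open>The system is singular here: \<open>t = r\<close> and \<open>k = 1 / r\<close>, so that both equations say \<open>p + q = 1\<close>.\<close>
    have "t = r"
    proof (rule ccontr)
      assume "t \<noteq> r"
      moreover have "k > 0"
        using True k(2) c by (cases "k = 0") auto
      ultimately have "t * k < r * k"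
        using t' by simp
      then show False
        using kr True c by (simp add: mult.commute)
    qed
    then show ?thesis
      using True r c by (intro that[of "1/2" "1/2"]) (simp_all add: field_simps)
  next
    case False
    then have d: "0 < 1 - c" "0 < 1 + c"
      using c' by simp_all
    define e where "e = (1 - c) * (1 + c)"
    have e: "0 < e"
      using d by (simp add: e_def)
    have e2: "e = 1 - c * t * k"
      by (simp add: e_def c algebra_simps)
    define p q where "p = (1 - c * t / r) / e" and "q = (1 - k * r) / e"
    have pe: "p * e = 1 - c * t / r" and qe: "q * e = 1 - k * r"
      using e by (simp_all add: p_def q_def)
    have "e * (p + q * (c * t / r)) = p * e + (q * e) * (c * t / r)"
      by (simp add: algebra_simps)
    also have "\<dots> = e * 1"
      unfolding pe qe unfolding e2 using r by (simp add: field_simps)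
    finally have 1: "p + q * (c * t / r) = 1"
      using e by (simp only: mult_cancel_left) simp
    have "e * (q + p * (k * r)) = q * e + (p * e) * (k * r)"
      by (simp add: algebra_simps)
    also have "\<dots> = e * 1"
      unfolding pe qe unfolding e2 using r by (simp add: field_simps)
    finally have 2: "q + p * (k * r) = 1"
      using e by (simp only: mult_cancel_left) simp
    have "(1 - c) * ((p * r + q * t) * (1 + c)) = (p * e) * r + (q * e) * t"
      by (simp add: e_def algebra_simps)
    also have "\<dots> = (1 - c) * (r + t)"
      unfolding pe qe using r by (simp add: c algebra_simps)
    finally have 3: "(p * r + q * t) * (1 + c) = r + t"
      using d by (simp only: mult_cancel_left) simp
    show ?thesis
      using 1 2 3 e r kr c' by (intro that[of p q]) (simp_all add: p_def q_def)
  qed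
  have "p * y1 + q * C * cnj y2 = of_real (p + q * (c * t / r)) * y1"
    by (simp add: mult.assoc C2) (simp add: algebra_simps)
  then have eq1: "p * y1 + q * C * cnj y2 = y1"
    unfolding pq(3) by simp
  have "q * y2 + p * C * cnj y1 = of_real (q + p * (k * r)) * y2"
    by (simp add: mult.assoc C1) (simp add: algebra_simps)
  then have eq2: "q * y2 + p * C * cnj y1 = y2"
    unfolding pq(4) by simp
  have "(p * r + q * t) * (1 + c) \<le> (1 - cmod y3) * (1 + c)"
    unfolding pq(5) using k(4) by (simp add: rt c)
  then have "cmod y3 + p * cmod y1 + q * cmod y2 \<le> 1"
    using c'(1) by (simp add: rt)
  then show ?thesis
    using pq(1,2) c'(2) C eq1 eq2 by metis
qed

lemma schwarz_coeff_weights: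
  fixes y1 y2 y3 C :: complex
  assumes "max (cmod y1) (cmod y2) + cmod y3 \<le> 1"
  defines "C \<equiv> schwarz_coeff y1 y2 y3"
  obtains p q :: real where "p \<ge> 0" "q \<ge> 0" "cmod C \<le> 1"
    "p * y1 + q * C * cnj y2 = y1" "q * y2 + p * C * cnj y1 = y2"
    "cmod y3 + p * cmod y1 + q * cmod y2 \<le> 1"
proof (cases "cmod y2 \<le> cmod y1")
  case True
  then show ?thesis
    using schwarz_coeff_weights_ordered[of y2 y1 y3] assms that by auto
next
  case False
  then have "cmod y1 \<le> cmod y2" "cmod y2 + cmod y3 \<le> 1"
    using assms by simp_all
  from schwarz_coeff_weights_ordered[OF this] obtain q p :: real where
    "cmod C \<le> 1" "q \<ge> 0" "p \<ge> 0" "q * y2 + p * C * cnj y1 = y2" "p * y1 + q * C * cnj y2 = y1"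
    "cmod y3 + q * cmod y2 + p * cmod y1 \<le> 1"
    unfolding C_def schwarz_coeff_commute[of y1 y2 y3] by blast
  then show ?thesis
    by (intro that[of p q]) simp_all
qed

section \<open>The Schwarz lemma construction\<close>

theorem theorem2p2:
  fixes y1 y2 y3 :: complex
  assumes "max (cmod y1) (cmod y2) + cmod y3 \<le> 1"
  shows "(\<forall>i. (\<lambda>l. schwarz_map y1 y2 y3 l $ i) holomorphic_on ball 0 1)
    \<and> schwarz_map y1 y2 y3 ` ball 0 1 \<subseteq> tetrablock
    \<and> schwarz_map y1 y2 y3 0 = 0
    \<and> (\<forall>i. ((\<lambda>l. schwarz_map y1 y2 y3 l $ i) has_field_derivative
              (vector [y1, y2, y3] :: complex ^ 3) $ i) (at 0))"
proof (intro conjI)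
  define C where "C = schwarz_coeff y1 y2 y3"
  have nonzero: "1 + l * (C * cnj y3 - y1 * z - y2 * w + y3 * z * w) + l\<^sup>2 * C * z * w \<noteq> 0"
    if "cmod l < 1" "cmod z \<le> 1" "cmod w \<le> 1" for l z w
    using schwarz_coeff_weights[OF assms] nonzero_on_torus nonzero_on_closed_bidisc that
    unfolding C_def by metis
  have denom: "1 + l * cnj y3 * C \<noteq> 0" if "cmod l < 1" for l
    using nonzero[OF that, of 0 0] by (simp add: mult_ac)
  have component: "schwarz_map y1 y2 y3 l $ 1 = l / (1 + l * cnj y3 * C) * y1"
    "schwarz_map y1 y2 y3 l $ 2 = l / (1 + l * cnj y3 * C) * y2"
    "schwarz_map y1 y2 y3 l $ 3 = l / (1 + l * cnj y3 * C) * (C * l + y3)" for l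
    by (simp_all add: schwarz_map_def C_def)
  show "\<forall>i. (\<lambda>l. schwarz_map y1 y2 y3 l $ i) holomorphic_on ball 0 1"
    unfolding forall_3 component by (intro conjI holomorphic_intros) (simp_all add: denom)
  show "schwarz_map y1 y2 y3 ` ball 0 1 \<subseteq> tetrablock"
  proof (clarsimp simp: tetrablock_def component simp del: times_divide_eq_left)
    fix l z w :: complex
    assume l: "cmod l < 1" and z: "cmod z \<le> 1" and w: "cmod w \<le> 1"
    define D where "D = 1 + l * cnj y3 * C"
    assume zero: "1 - l / (1 + l * cnj y3 * C) * y1 * z - l / (1 + l * cnj y3 * C) * y2 * w
      + l / (1 + l * cnj y3 * C) * (C * l + y3) * z * w = 0"
    have D: "D \<noteq> 0"
      using denom[OF l] by (simp add: D_def)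
    have "1 + l * (C * cnj y3 - y1 * z - y2 * w + y3 * z * w) + l\<^sup>2 * C * z * w
      = D - l * y1 * z - l * y2 * w + l * (C * l + y3) * z * w"
      by (simp add: D_def power2_eq_square algebra_simps)
    also have "\<dots> = D * (1 - l / D * y1 * z - l / D * y2 * w + l / D * (C * l + y3) * z * w)"
      using D by (simp add: field_simps)
    also have "\<dots> = 0"
      using zero by (simp add: D_def)
    finally show False
      using nonzero[OF l z w] by simp
  qed
  show "schwarz_map y1 y2 y3 0 = 0"
    by (simp add: schwarz_map_def)
  show "\<forall>i. ((\<lambda>l. schwarz_map y1 y2 y3 l $ i) has_field_derivative
      (vector [y1, y2, y3] :: complex ^ 3) $ i) (at 0)"
    unfolding forall_3 component by (auto intro!: derivative_eq_intros)
qed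

end
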